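(* Consider the crowdsourcing scheduling problem described in the context. Let $WCT_{OPT}$ be the minimum total weighted completion time and $WCT_{LRF}$ the total weighted completion time of the schedule produced by the LRF algorithm. Then $$\frac{WCT_{LRF}}{WCT_{OPT}} \leq \max\left\{\frac{3}{2},\frac{w_{max}\cdot\lambda_{max}}{w_{min}\cdot\lambda_{min}}\right\}.$$
   Context: Crowdsourcing scheduling problem: there are $m\ge 1$ crowd workers $u_1,\dots,u_m$, worker $u_j$ having a rate $\lambda_j>0$, and $n$ indivisible tasks $s_1,\dots,s_n$, task $s_i$ having required service time $\tau_i>0$ and weight $w_i>0$. A schedule partitions the tasks into disjoint sets $\mathcal{S}_1,\dots,\mathcal{S}_m$ ($\mathcal{S}_j$ is processed by $u_j$) and fixes a processing order within each $\mathcal{S}_j$; each worker processes its tasks sequentially. If $s_i\in\mathcal{S}_j$, its completion time is $C_i=\frac{2}{\lambda_j}+\sum\tau_k$, the sum over all tasks $s_k\in\mathcal{S}_j$ processed before $s_i$ together with $s_i$ itself. The total weighted completion time is $\sum_{i=1}^n w_iC_i$. $w_{max}=\max_i w_i$, $w_{min}=\min_i w_i$, $\lambda_{max}=\max_j\lambda_j$, $\lambda_{min}=\min_j\lambda_j$. LRF (Largest-Ratio-First) algorithm: the tasks are indexed so that $\frac{w_1}{\tau_1}\ge\cdots\ge\frac{w_n}{\tau_n}$; initialize $\mathcal{S}_j=\emptyset$ and $EW_j=\frac{2}{\lambda_j}$ for all $j$; for $i=1,\dots,n$ in turn, pick $j_{\min}=\arg\min_k EW_k$, add $s_i$ to $\mathcal{S}_{j_{\min}}$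 and increase $EW_{j_{\min}}$ by $\tau_i$. Each worker processes its tasks in the order they were assigned. *)

theory Defs
  imports Complex_Main "HOL-Library.Multiset"
begin

text \<open>
  Workers are numbered by \<open>j < m\<close> and tasks by \<open>i < n\<close>.  A schedule is a list of \<open>m\<close> lists:
  \<open>S ! j\<close> lists the tasks of worker \<open>j\<close> in processing order.  Distinctness of the concatenation
  says that no list repeats a task and that different workers have disjoint task sets.
\<close>

definition schedules :: "nat \<Rightarrow> nat \<Rightarrow> nat list list set" where
  "schedules m n = {S. length S = m \<and> distinct (concat S) \<and> set (concat S) = {..<n}}"

definition worker_of :: "nat list list \<Rightarrow> nat \<Rightarrow> nat" where
  "worker_of S i = (THE j. j < length S \<and> i \<in> set (S ! j))"

definition completion_time ::
  "(nat \<Rightarrow> real) \<Rightarrow> (nat \<Rightarrow> real) \<Rightarrow> nat list list \<Rightarrow> nat \<Rightarrow> real" where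
  "completion_time lam tau S i =
     (let j = worker_of S i
      in 2 / lam j + (\<Sum>k\<leftarrow>takeWhile (\<lambda>k. k \<noteq> i) (S ! j) @ [i]. tau k))"

definition wct ::
  "nat \<Rightarrow> (nat \<Rightarrow> real) \<Rightarrow> (nat \<Rightarrow> real) \<Rightarrow> (nat \<Rightarrow> real) \<Rightarrow> nat list list \<Rightarrow> real" where
  "wct n lam tau w S = (\<Sum>i<n. w i * completion_time lam tau S i)"

definition wct_opt ::
  "nat \<Rightarrow> nat \<Rightarrow> (nat \<Rightarrow> real) \<Rightarrow> (nat \<Rightarrow> real) \<Rightarrow> (nat \<Rightarrow> real) \<Rightarrow> real" where
  "wct_opt m n lam tau w = Min (wct n lam tau w ` schedules m n)"

text \<open>
  The Largest-Ratio-First algorithm on states \<open>(S, EW)\<close>.  It is a relation rather than a function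
  because ties in the arg min, and below among equal ratios, may be broken arbitrarily.
\<close>

inductive lrf_run ::
  "(nat \<Rightarrow> real) \<Rightarrow> nat list \<Rightarrow> nat list list \<times> real list \<Rightarrow> nat list list \<times> real list \<Rightarrow> bool"
  for tau :: "nat \<Rightarrow> real" where
  finish: "lrf_run tau [] st st"
| assign: "\<lbrakk>is_arg_min (\<lambda>k. EW ! k) (\<lambda>k. k < length EW) j;
            lrf_run tau is (S[j := S ! j @ [i]], EW[j := EW ! j + tau i]) st\<rbrakk>
           \<Longrightarrow> lrf_run tau (i # is) (S, EW) st"

definition lrf_order :: "nat \<Rightarrow> (nat \<Rightarrow> real) \<Rightarrow> (nat \<Rightarrow> real) \<Rightarrow> nat list \<Rightarrow> bool" where
  "lrf_order n tau w is \<longleftrightarrow>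
     distinct is \<and> set is = {..<n} \<and> sorted_wrt (\<lambda>i k. w i / tau i \<ge> w k / tau k) is"

definition lrf_schedule ::
  "nat \<Rightarrow> nat \<Rightarrow> (nat \<Rightarrow> real) \<Rightarrow> (nat \<Rightarrow> real) \<Rightarrow> (nat \<Rightarrow> real) \<Rightarrow> nat list list \<Rightarrow> bool" where
  "lrf_schedule m n lam tau w S \<longleftrightarrow>
     (\<exists>is EW. lrf_order n tau w is \<and>
        lrf_run tau is (replicate m [], map (\<lambda>j. 2 / lam j) [0..<m]) (S, EW))"

text \<open>The minimum in \<open>wct_opt\<close> ranges over a finite nonempty set, so it is attained.\<close>

lemma finite_schedules: "finite (schedules m n)"
proof -
  let ?L = "{xs. set xs \<subseteq> {..<n} \<and> length xs \<le> n}"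
  have "finite ?L" by (rule finite_lists_length_le) simp
  then have "finite {S. set S \<subseteq> ?L \<and> length S = m}"
    by (rule finite_lists_length_eq)
  moreover have "schedules m n \<subseteq> {S. set S \<subseteq> ?L \<and> length S = m}"
  proof
    fix S assume S: "S \<in> schedules m n"
    have "xs \<in> ?L" if xs: "xs \<in> set S" for xs
    proof -
      have d: "distinct xs" using S xs by (auto simp: schedules_def distinct_concat_iff)
      have s: "set xs \<subseteq> {..<n}" using S xs by (auto simp: schedules_def)
      have "length xs \<le> n"
        using card_mono[OF _ s] distinct_card[OF d] by simp
      with s show ?thesis by simp
    qed
    then show "S \<in> {S. set S \<subseteq> ?L \<and> length S = m}"
      using S by (auto simp: schedules_def)
  qed
  ultimately show ?thesis by (rule finite_subset[rotated])
qed

lemma schedules_nonempty: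
  assumes "m \<ge> 1"
  shows "schedules m n \<noteq> {}"
proof -
  have "[0..<n] # replicate (m - 1) [] \<in> schedules m n"
    using assms by (auto simp: schedules_def)
  then show ?thesis by blast
qed

lemma wct_opt_attained:
  assumes "m \<ge> 1"
  shows "\<exists>S\<in>schedules m n. wct_opt m n lam tau w = wct n lam tau w S"
  using Min_in[of "wct n lam tau w ` schedules m n"] finite_schedules schedules_nonempty[OF assms]
  unfolding wct_opt_def by blast

lemma worker_of_eq:
  assumes "S \<in> schedules m n" "j < m" "i \<in> set (S ! j)"
  shows "worker_of S i = j"
  unfolding worker_of_def
proof (rule the_equality)
  show "j < length S \<and> i \<in> set (S ! j)" using assms by (simp add: schedules_def)
next
  fix k assume k: "k < length S \<and> i \<in> set (S ! k)"
  have S: "distinct (concat S)" "length S = m" using assms by (auto simp: schedules_def)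
  show "k = j"
  proof (rule ccontr)
    assume "k \<noteq> j"
    then consider "k < j" | "j < k" by linarith
    then have "\<exists>a b. a < b \<and> b < m \<and> i \<in> set (S ! a) \<and> i \<in> set (S ! b)"
      using k S(2) assms(2,3) by cases auto
    then obtain a b where ab: "a < b" "b < m" "i \<in> set (S ! a)" "i \<in> set (S ! b)" by blast
    have "take b S ! a = S ! a" "a < length (take b S)" using ab S(2) by auto
    then have a: "S ! a \<in> set (take b S)" by (metis nth_mem)
    have "distinct (concat (take b S) @ concat (drop b S))"
      using S(1) by (simp flip: concat_append)
    moreover have "i \<in> set (concat (take b S))"
      using a ab(3) by auto
    moreover have "i \<in> set (concat (drop b S))"
      using ab S(2) by (auto simp: Cons_nth_drop_Suc[symmetric])
    ultimately show False by auto
  qed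
qed

text \<open>Every run of the algorithm yields a schedule, and a run exists.\<close>

lemma mset_concat_update:
  "j < length S \<Longrightarrow> mset (concat (S[j := S ! j @ [i]])) = mset (concat S) + {#i#}"
proof (induction S arbitrary: j)
  case (Cons xs S)
  then show ?case by (cases j) auto
qed simp

lemma lrf_run_mset:
  assumes "lrf_run tau is st st'" "length (fst st) = length (snd st)"
  shows "length (fst st') = length (fst st) \<and> mset (concat (fst st')) = mset (concat (fst st)) + mset is"
  using assms
proof (induction rule: lrf_run.induct)
  case (assign EW j ks S i st)
  then have "j < length S" by (simp add: is_arg_min_def)
  with assign show ?case by (simp add: mset_concat_update)
qed simp

lemma lrf_schedule_in_schedules:
  assumes "lrf_schedule m n lam tau w S"
  shows "S \<in> schedules m n"
proof -
  from assms obtain is' EW where o: "lrf_order n tau w is'"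
    and r: "lrf_run tau is' (replicate m [], map (\<lambda>j. 2 / lam j) [0..<m]) (S, EW)"
    by (auto simp: lrf_schedule_def)
  have "concat (replicate m []) = ([] :: nat list)" by simp
  with lrf_run_mset[OF r] have "length S = m" "mset (concat S) = mset is'" by simp_all
  with o show ?thesis
    using mset_eq_imp_distinct_iff[of "concat S" is'] mset_eq_setD[of "concat S" is']
    by (simp add: schedules_def lrf_order_def del: set_concat)
qed

lemma lrf_run_exists:
  assumes "length EW \<ge> 1"
  shows "\<exists>st. lrf_run tau is (S, EW) st"
  using assms
proof (induction "is" arbitrary: S EW)
  case Nil
  then show ?case by (blast intro: lrf_run.finish)
next
  case (Cons i ks)
  have "finite {..<length EW}" "{..<length EW} \<noteq> {}" using Cons.prems by (auto simp: lessThan_empty_iff)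
  from ex_is_arg_min_if_finite[OF this, of "\<lambda>k. EW ! k"]
  obtain j where "is_arg_min (\<lambda>k. EW ! k) (\<lambda>k. k < length EW) j" by auto
  moreover obtain st where "lrf_run tau ks (S[j := S ! j @ [i]], EW[j := EW ! j + tau i]) st"
    using Cons.IH[of "EW[j := EW ! j + tau i]"] Cons.prems by fastforce
  ultimately show ?case by (blast intro: lrf_run.assign)
qed

lemma lrf_schedule_exists:
  assumes "m \<ge> 1"
  shows "\<exists>S. lrf_schedule m n lam tau w S"
proof -
  let ?is = "sort_key (\<lambda>i. - (w i / tau i)) [0..<n]"
  have "sorted (map (\<lambda>i. - (w i / tau i)) ?is)" by simp
  then have "lrf_order n tau w ?is"
    by (auto simp: lrf_order_def sorted_wrt_map)
  moreover obtain S EW where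
    "lrf_run tau ?is (replicate m [], map (\<lambda>j. 2 / lam j) [0..<m]) (S, EW)"
    using lrf_run_exists[of "map (\<lambda>j. 2 / lam j) [0..<m]"] assms by fastforce
  ultimately show ?thesis by (auto simp: lrf_schedule_def)
qed

end

theory Submission
  imports Defs
begin

text \<open>
  The constant \<open>3 / 2\<close> alone is already a bound.  By Abel summation over the decreasing ratios
  \<open>w / tau\<close> it suffices to compare, for each prefix of the LRF order, the sums weighted by \<open>tau\<close>.
  In any schedule the midpoints of the processing intervals of the prefix satisfy
  \<open>2 (\<Sum>i. tau i * (C i - tau i / 2)) \<ge> (\<Sum>j. (r j + L j)\<^sup>2 - (r j)\<^sup>2)\<close>, where \<open>r j = 2 / lam j\<close> and \<open>L j\<close>
  is the load of the prefix on worker \<open>j\<close>.  On the other hand the start times \<open>s i\<close> of LRF satisfy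
  \<open>2 (\<Sum>i. tau i * s i) \<le> (\<Sum>j. (r j + L j)\<^sup>2 - (r j)\<^sup>2)\<close> for every distribution \<open>L\<close> of the same total
  load, even a fractional one, since a task is started at the lowest level.  Hence LRF exceeds the
  optimum by at most \<open>(\<Sum>i. w i * tau i) / 2\<close>, which is at most half the optimum.
\<close>

section \<open>Abel summation over lists\<close>

text \<open>Induction from the right, with \<open>c\<close> free so that the hypothesis can be used
  at the last, hence smallest, ratio. Lowering that ratio to \<open>c\<close> only increases the
  product, as the total is nonpositive.\<close>

lemma sum_list_weighted_le_if_prefix_sums_nonpos:
  fixes d \<rho> :: "'a \<Rightarrow> real"
  assumes "sorted_wrt (\<lambda>x y. \<rho> x \<ge> \<rho> y) xs"
    and "\<And>ys zs. xs = ys @ zs \<Longrightarrow> (\<Sum>x\<leftarrow>ys. d x) \<le> 0"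
    and "\<And>x. x \<in> set xs \<Longrightarrow> c \<le> \<rho> x"
  shows "(\<Sum>x\<leftarrow>xs. \<rho> x * d x) \<le> c * (\<Sum>x\<leftarrow>xs. d x)"
  using assms
proof (induction xs arbitrary: c rule: rev_induct)
  case (snoc x xs)
  have "(\<Sum>x\<leftarrow>xs. \<rho> x * d x) \<le> \<rho> x * (\<Sum>x\<leftarrow>xs. d x)"
    using snoc.prems(1,2) by (intro snoc.IH) (auto simp: sorted_wrt_append)
  then have "(\<Sum>x\<leftarrow>xs @ [x]. \<rho> x * d x) \<le> \<rho> x * (\<Sum>x\<leftarrow>xs @ [x]. d x)"
    by (simp add: algebra_simps)
  also have "\<dots> \<le> c * (\<Sum>x\<leftarrow>xs @ [x]. d x)"
    using snoc.prems(2)[of "xs @ [x]" "[]"] snoc.prems(3)[of x] by (intro mult_right_mono_neg) auto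
  finally show ?case .
qed simp

section \<open>Sums and completion times in schedules\<close>

lemma sum_schedule:
  assumes "S \<in> schedules m n"
  shows "(\<Sum>i<n. f i) = (\<Sum>j<m. \<Sum>i\<leftarrow>S ! j. f i)"
proof -
  have "(\<Sum>i<n. f i) = (\<Sum>i\<leftarrow>concat S. f i)"
    using assms sum_list_distinct_conv_sum_set[of "concat S" f] by (simp add: schedules_def)
  also have "\<dots> = (\<Sum>ys\<leftarrow>S. \<Sum>i\<leftarrow>ys. f i)"
    by (induction S) auto
  also have "\<dots> = (\<Sum>j<m. \<Sum>i\<leftarrow>S ! j. f i)"
    using assms by (simp add: schedules_def sum_list_sum_nth atLeast0LessThan)
  finally show ?thesis .
qed

lemma completion_time_schedule:
  assumes "S \<in> schedules m n" "j < m" "i \<in> set (S ! j)"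
  shows "completion_time lam tau S i
    = 2 / lam j + (\<Sum>k\<leftarrow>takeWhile (\<lambda>k. k \<noteq> i) (S ! j). tau k) + tau i"
  using worker_of_eq[OF assms] by (simp add: completion_time_def)

lemma list_in_schedule:
  assumes "S \<in> schedules m n" "j < m"
  shows "distinct (S ! j)" "set (S ! j) \<subseteq> {..<n}"
  using assms by (auto simp: schedules_def distinct_concat_iff)

lemma in_list_of_schedule:
  assumes "S \<in> schedules m n" "i < n"
  obtains j where "j < m" "i \<in> set (S ! j)"
proof -
  have "i \<in> set (concat S)" using assms by (simp add: schedules_def)
  then show ?thesis
    using assms(1) that by (auto simp: schedules_def in_set_conv_nth) (metis in_set_conv_nth)
qed

lemma tau_le_completion_time:
  assumes "S \<in> schedules m n" "i < n"
    and "\<And>j. j < m \<Longrightarrow> lam j > 0" "\<And>i. i < n \<Longrightarrow> tau i > 0"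
  shows "tau i \<le> completion_time lam tau S i"
proof -
  obtain j where j: "j < m" "i \<in> set (S ! j)"
    using in_list_of_schedule assms by blast
  have "0 \<le> (\<Sum>k\<leftarrow>takeWhile (\<lambda>k. k \<noteq> i) (S ! j). tau k)"
    using list_in_schedule(2)[OF assms(1) j(1)] assms(4)
    by (intro sum_list_nonneg) (force dest: set_takeWhileD)
  moreover have "0 < 2 / lam j" using assms(3)[OF j(1)] by simp
  ultimately show ?thesis
    using completion_time_schedule[OF assms(1) j] by simp
qed

section \<open>Squares of loads\<close>

text \<open>Here \<open>g\<close> will be \<open>tau\<close> restricted to a prefix of the LRF order.\<close>

lemma square_le_list_processing:
  fixes g tau :: "'a \<Rightarrow> real"
  assumes "distinct xs" and "\<And>x. x \<in> set xs \<Longrightarrow> 0 \<le> g x \<and> g x \<le> tau x"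
  shows "(r + (\<Sum>x\<leftarrow>xs. g x))\<^sup>2
    \<le> r\<^sup>2 + (\<Sum>x\<leftarrow>xs. g x * (2 * (r + (\<Sum>k\<leftarrow>takeWhile (\<lambda>k. k \<noteq> x) xs. tau k)) + tau x))"
  using assms
proof (induction xs rule: rev_induct)
  case (snoc y xs)
  let ?G = "\<Sum>x\<leftarrow>xs. g x" and ?T = "\<Sum>x\<leftarrow>xs. tau x"
  let ?f = "\<lambda>xs x. g x * (2 * (r + (\<Sum>k\<leftarrow>takeWhile (\<lambda>k. k \<noteq> x) xs. tau k)) + tau x)"
  have y: "y \<notin> set xs" "0 \<le> g y" "g y \<le> tau y" using snoc.prems by auto
  have "?G \<le> ?T" using snoc.prems by (intro sum_list_mono) auto
  \<comment> \<open>The left side is the growth of the square when \<open>g y\<close> is appended;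
    on the right, \<open>y\<close> starts only after all of \<open>?T\<close>.\<close>
  then have "g y * (2 * (r + ?G) + g y) \<le> g y * (2 * (r + ?T) + tau y)"
    using y by (intro mult_left_mono) auto
  moreover have "takeWhile (\<lambda>k. k \<noteq> y) (xs @ [y]) = xs"
    using y(1) by (subst takeWhile_append2) auto
  moreover have "(\<Sum>x\<leftarrow>xs. ?f (xs @ [y]) x) = (\<Sum>x\<leftarrow>xs. ?f xs x)"
    by (intro arg_cong[of _ _ sum_list] map_cong) (auto simp: takeWhile_append1)
  moreover have "(r + ?G)\<^sup>2 \<le> r\<^sup>2 + (\<Sum>x\<leftarrow>xs. ?f xs x)"
    using snoc by auto
  ultimately show ?case by (simp add: power2_eq_square algebra_simps)
qed simp

text \<open>
  The load of \<open>L\<close> above level \<open>s\<close> is at least \<open>t\<close>, since the levels \<open>E\<close> show that at most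
  \<open>\<Sum>E - \<Sum>r\<close> fits below; an amount \<open>t\<close> of it is removed proportionally.
\<close>

lemma remove_load_above_level:
  fixes E r L :: "'a \<Rightarrow> real"
  assumes "finite J" and "\<And>j. j \<in> J \<Longrightarrow> s \<le> E j" and "\<And>j. j \<in> J \<Longrightarrow> r j \<le> E j"
    and "\<And>j. j \<in> J \<Longrightarrow> 0 \<le> L j" and "t > 0" and "sum L J = sum E J - sum r J + t"
  obtains L' where "\<And>j. j \<in> J \<Longrightarrow> 0 \<le> L' j" "sum L' J = sum E J - sum r J"
    "(\<Sum>j\<in>J. (r j + L' j)\<^sup>2) + 2 * s * t \<le> (\<Sum>j\<in>J. (r j + L j)\<^sup>2)"
proof -
  \<comment> \<open>With the load of \<open>j\<close> stacked from \<open>r j\<close> upwards, the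
    minimum is the part below level \<open>s\<close>, and \<open>a j\<close> the part above.\<close>
  define a where "a j = L j - min (L j) (max 0 (s - r j))" for j
  define B where "B = sum a J"
  define L' where "L' j = L j - a j * (t / B)" for j
  \<comment> \<open>Both \<open>s\<close> and \<open>r j\<close> are at most \<open>E j\<close>, so
    the part below \<open>s\<close> is at most \<open>E j - r j\<close>.\<close>
  have "sum a J \<ge> (\<Sum>j\<in>J. L j - (E j - r j))"
    using assms(2,3) by (intro sum_mono) (force simp: a_def)
  then have B: "t \<le> B" using assms(6) by (simp add: B_def sum_subtractf)
  then have q: "0 \<le> t / B" "t / B \<le> 1" using assms(5) by auto
  have a: "0 \<le> a j" "a j \<le> L j" "a j > 0 \<Longrightarrow> s \<le> r j + L j - a j" if "j \<in> J" for j
    using assms(4)[OF that] by (auto simp: a_def min_def max_def split: if_splits)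
  have le: "a j * (t / B) \<le> a j" if "j \<in> J" for j
    using a(1)[OF that] q(2) by (rule mult_left_le[rotated])
  have sum_removed: "(\<Sum>j\<in>J. a j * (t / B)) = t"
    using B assms(5) by (simp add: B_def flip: sum_distrib_right sum_divide_distrib)
  show ?thesis
  proof
    show "0 \<le> L' j" if "j \<in> J" for j
      using a[OF that] le[OF that] by (simp add: L'_def)
    show "sum L' J = sum E J - sum r J"
      using sum_removed assms(6) by (simp add: L'_def sum_subtractf)
    have "(r j + L' j)\<^sup>2 + 2 * s * (a j * (t / B)) \<le> (r j + L j)\<^sup>2" if j: "j \<in> J" for j
    proof (cases "a j = 0")
      case False
      define \<delta> where "\<delta> = a j * (t / B)"
      have "\<delta> \<le> a j" "0 \<le> \<delta>"
        using le[OF j] a(1)[OF j] q(1) unfolding \<delta>_def by (blast intro: mult_nonneg_nonneg)+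
      moreover have "s \<le> r j + L j - a j" using a(1,3)[OF j] False by simp
      ultimately have "0 \<le> \<delta>" "0 \<le> r j + L j - \<delta> - s" by simp_all
      \<comment> \<open>The slice of height \<open>\<delta>\<close> taken off the top lies above
        \<open>s\<close>, so the square drops by at least \<open>2 * s * \<delta>\<close>.\<close>
      then have "0 \<le> \<delta> * (2 * (r j + L j - \<delta> - s) + \<delta>)"
        by (intro mult_nonneg_nonneg add_nonneg_nonneg) simp_all
      also have "\<dots> = (r j + L j)\<^sup>2 - (r j + L' j)\<^sup>2 - 2 * s * \<delta>"
        unfolding L'_def \<delta>_def by algebra
      finally show ?thesis by (simp add: \<delta>_def)
    qed (simp add: L'_def)
    then have "(\<Sum>j\<in>J. (r j + L' j)\<^sup>2 + 2 * s * (a j * (t / B))) \<le> (\<Sum>j\<in>J. (r j + L j)\<^sup>2)"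
      by (rule sum_mono)
    then show "(\<Sum>j\<in>J. (r j + L' j)\<^sup>2) + 2 * s * t \<le> (\<Sum>j\<in>J. (r j + L j)\<^sup>2)"
      by (simp only: sum.distrib sum_removed flip: sum_distrib_left)
  qed
qed

section \<open>The load bound along a run of LRF\<close>

text \<open>Tasks are only appended, so the predecessors of a task in the final list are those
  present when it is assigned.\<close>

lemma lrf_run_extends:
  assumes "lrf_run tau is st st'" "length (fst st) = length (snd st)"
  shows "\<exists>zs. fst st' ! j = fst st ! j @ zs"
  using assms
proof (induction rule: lrf_run.induct)
  case (assign EW k ks S i st)
  then have "k < length S" by (simp add: is_arg_min_def)
  with assign show ?case by (cases "j = k") auto
qed simp

text \<open>\<open>C x - tau x\<close> is a start time. Quantifying over all nonnegative real loads
  keeps the induction closed: proportional removal may give loads that no schedule realizes.\<close>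

definition load_bound ::
  "nat \<Rightarrow> (nat \<Rightarrow> real) \<Rightarrow> (nat \<Rightarrow> real) \<Rightarrow> (nat \<Rightarrow> real) \<Rightarrow> nat list \<Rightarrow> bool" where
  "load_bound m r tau C xs \<longleftrightarrow>
     (\<forall>L. (\<forall>j<m. 0 \<le> L j) \<and> (\<Sum>j<m. L j) = (\<Sum>x\<leftarrow>xs. tau x) \<longrightarrow>
        (\<Sum>j<m. (r j)\<^sup>2) + 2 * (\<Sum>x\<leftarrow>xs. tau x * (C x - tau x)) \<le> (\<Sum>j<m. (r j + L j)\<^sup>2))"

text \<open>Induction along the run: \<open>xs\<close> stands for the tasks assigned so far,
  \<open>ys\<close> for a prefix of those to come. Completion times refer to the final schedule
  throughout, so each new task adds just one summand.\<close>

lemma lrf_run_load_bound: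
  assumes "lrf_run tau is st st'"
    and "fst st' \<in> schedules m n" "length (fst st) = m" "length (snd st) = m"
    and "set is \<subseteq> {..<n}" and "\<And>i. i < n \<Longrightarrow> tau i > 0"
    and "\<And>j. j < m \<Longrightarrow> snd st ! j = 2 / lam j + (\<Sum>i\<leftarrow>fst st ! j. tau i)"
    and "\<And>j. j < m \<Longrightarrow> 2 / lam j \<le> snd st ! j"
    and "(\<Sum>j<m. snd st ! j) = (\<Sum>j<m. 2 / lam j) + (\<Sum>x\<leftarrow>xs. tau x)"
    and "load_bound m (\<lambda>j. 2 / lam j) tau (completion_time lam tau (fst st')) xs"
    and "is = ys @ zs"
  shows "load_bound m (\<lambda>j. 2 / lam j) tau (completion_time lam tau (fst st')) (xs @ ys)"
  using assms
proof (induction arbitrary: xs ys rule: lrf_run.induct)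
  case (assign E j ks S i st)
  let ?r = "\<lambda>j. 2 / lam j" and ?C = "completion_time lam tau (fst st)"
  let ?E = "E[j := E ! j + tau i]" and ?S = "S[j := S ! j @ [i]]"
  note len = assign.prems(2,3)[simplified]
  have j: "j < m" and jmin: "\<And>k. k < m \<Longrightarrow> E ! j \<le> E ! k"
    using assign.hyps(1) len by (auto simp: is_arg_min_def not_less) (metis not_less)
  have tau_i: "tau i > 0" using assign.prems(4,5) by auto
  obtain us where us: "fst st ! j = S ! j @ i # us"
    using lrf_run_extends[OF assign.hyps(2), of j] j len by auto
  have "i \<notin> set (S ! j)"
    using list_in_schedule(1)[OF assign.prems(1) j] us by auto
  then have "takeWhile (\<lambda>k. k \<noteq> i) (S ! j @ i # us) = S ! j"
    by (subst takeWhile_append2) auto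
  then have C: "?C i = E ! j + tau i"
    using completion_time_schedule[OF assign.prems(1) j, of i lam tau] us assign.prems(6)[OF j]
    by simp
  have sumE: "(\<Sum>k<m. E ! k) = (\<Sum>k<m. ?r k) + (\<Sum>x\<leftarrow>xs. tau x)"
    using assign.prems(8) by simp
  have bound: "load_bound m ?r tau ?C (xs @ [i])"
    unfolding load_bound_def
  proof (intro allI impI, elim conjE)
    fix L assume L: "\<forall>k<m. 0 \<le> L k" "(\<Sum>k<m. L k) = (\<Sum>x\<leftarrow>xs @ [i]. tau x)"
    \<comment> \<open>The level is \<open>E ! j\<close>, the start time of \<open>i\<close> and the
      lowest level. Removing \<open>tau i\<close> pays for the summand of \<open>i\<close> and
      leaves loads to which the bound for \<open>xs\<close> applies.\<close>
    obtain L' where L': "\<And>k. k \<in> {..<m} \<Longrightarrow> 0 \<le> L' k"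
      "(\<Sum>k<m. L' k) = (\<Sum>k<m. E ! k) - (\<Sum>k<m. ?r k)"
      "(\<Sum>k<m. (?r k + L' k)\<^sup>2) + 2 * (E ! j) * tau i \<le> (\<Sum>k<m. (?r k + L k)\<^sup>2)"
    proof (rule remove_load_above_level[of "{..<m}" "E ! j" "(!) E" ?r L "tau i"])
      show "(\<Sum>k<m. L k) = (\<Sum>k<m. E ! k) - (\<Sum>k<m. ?r k) + tau i"
        using L(2) sumE by simp
    qed (use jmin assign.prems(7) L(1) tau_i in auto)
    have "(\<Sum>k<m. (?r k)\<^sup>2) + 2 * (\<Sum>x\<leftarrow>xs. tau x * (?C x - tau x)) \<le> (\<Sum>k<m. (?r k + L' k)\<^sup>2)"
      using assign.prems(9) L'(1,2) sumE unfolding load_bound_def by auto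
    then show "(\<Sum>k<m. (?r k)\<^sup>2) + 2 * (\<Sum>x\<leftarrow>xs @ [i]. tau x * (?C x - tau x))
        \<le> (\<Sum>k<m. (?r k + L k)\<^sup>2)"
      using L'(3) C by (simp add: algebra_simps)
  qed
  show ?case
  proof (cases ys)
    case Nil
    then show ?thesis using assign.prems(9) by simp
  next
    case (Cons i' ys')
    then have ys: "ys = i # ys'" "ks = ys' @ zs" using assign.prems(10) by auto
    have nth_E: "?E ! k = E ! k + (if k = j then tau i else 0)" if "k < m" for k
      using that len by (simp add: nth_list_update)
    have "(\<Sum>k<m. ?E ! k) = (\<Sum>k<m. E ! k + (if k = j then tau i else 0))"
      using nth_E by (intro sum.cong) auto
    also have "\<dots> = (\<Sum>k<m. ?r k) + (\<Sum>x\<leftarrow>xs @ [i]. tau x)"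
      using j sumE by (simp add: sum.distrib)
    finally have sumE': "(\<Sum>k<m. ?E ! k) = (\<Sum>k<m. ?r k) + (\<Sum>x\<leftarrow>xs @ [i]. tau x)" .
    have "load_bound m ?r tau ?C ((xs @ [i]) @ ys')"
    proof (rule assign.IH)
      show "snd (?S, ?E) ! k = 2 / lam k + (\<Sum>i\<leftarrow>fst (?S, ?E) ! k. tau i)" if "k < m" for k
        using that assign.prems(6)[OF that] len by (cases "k = j") auto
      show "2 / lam k \<le> snd (?S, ?E) ! k" if "k < m" for k
        using assign.prems(7)[OF that] nth_E[OF that] tau_i by auto
    qed (use assign.prems bound sumE' ys in auto)
    then show ?thesis using ys by simp
  qed
qed simp

section \<open>Comparison with an arbitrary schedule\<close>

text \<open>The squared loads of \<open>xs\<close> in \<open>S'\<close> separate start times under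
  \<open>C\<close> from interval midpoints in \<open>S'\<close>; start against midpoint leaves the
  term \<open>tau x / 2\<close>.\<close>

lemma schedule_prefix_bound:
  assumes "S' \<in> schedules m n" and "distinct xs" "set xs \<subseteq> {..<n}"
    and "\<And>i. i < n \<Longrightarrow> tau i > 0"
    and "load_bound m (\<lambda>j. 2 / lam j) tau C xs"
  shows "(\<Sum>x\<leftarrow>xs. tau x * (C x - tau x / 2 - completion_time lam tau S' x)) \<le> 0"
proof -
  let ?r = "\<lambda>j. 2 / lam j" and ?C' = "completion_time lam tau S'"
  \<comment> \<open>Tasks outside \<open>xs\<close> get weight zero but still delay the others in
    \<open>S'\<close>.\<close>
  define g where "g x = (if x \<in> set xs then tau x else 0)" for x
  define L where "L j = (\<Sum>x\<leftarrow>S' ! j. g x)" for j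
  have g: "0 \<le> g x \<and> g x \<le> tau x" if "x < n" for x
    using assms(4)[OF that] by (simp add: g_def)
  have sum_g: "(\<Sum>x<n. g x * f x) = (\<Sum>x\<leftarrow>xs. tau x * f x)" for f
  proof -
    have "(\<Sum>x<n. g x * f x) = (\<Sum>x\<in>set xs. g x * f x)"
      using assms(3) by (intro sum.mono_neutral_right) (auto simp: g_def)
    also have "\<dots> = (\<Sum>x\<in>set xs. tau x * f x)"
      by (intro sum.cong) (auto simp: g_def)
    finally show ?thesis
      using sum_list_distinct_conv_sum_set[OF assms(2)] by metis
  qed
  have "(\<Sum>j<m. (?r j)\<^sup>2) + 2 * (\<Sum>x\<leftarrow>xs. tau x * (C x - tau x)) \<le> (\<Sum>j<m. (?r j + L j)\<^sup>2)"
  proof -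
    have "\<forall>j<m. 0 \<le> L j"
      unfolding L_def using g list_in_schedule(2)[OF assms(1)] by (force intro!: sum_list_nonneg)
    moreover have "(\<Sum>j<m. L j) = (\<Sum>x\<leftarrow>xs. tau x)"
      using sum_schedule[OF assms(1), of g] sum_g[of "\<lambda>_. 1"] by (simp add: L_def)
    ultimately show ?thesis using assms(5) unfolding load_bound_def by blast
  qed
  also have "\<dots> \<le> (\<Sum>j<m. (?r j)\<^sup>2 + (\<Sum>x\<leftarrow>S' ! j. g x * (2 * ?C' x - tau x)))"
  proof (rule sum_mono)
    fix j assume "j \<in> {..<m}"
    then have j: "j < m" by simp
    have "(\<Sum>x\<leftarrow>S' ! j. g x * (2 * (?r j + (\<Sum>k\<leftarrow>takeWhile (\<lambda>k. k \<noteq> x) (S' ! j). tau k)) + tau x))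
        = (\<Sum>x\<leftarrow>S' ! j. g x * (2 * ?C' x - tau x))"
      using completion_time_schedule[OF assms(1) j, of _ lam tau]
      by (intro arg_cong[of _ _ sum_list] map_cong) simp_all
    then show "(?r j + L j)\<^sup>2 \<le> (?r j)\<^sup>2 + (\<Sum>x\<leftarrow>S' ! j. g x * (2 * ?C' x - tau x))"
      using square_le_list_processing[of "S' ! j" g tau "?r j"] g list_in_schedule[OF assms(1) j]
      by (auto simp: L_def)
  qed
  also have "\<dots> = (\<Sum>j<m. (?r j)\<^sup>2) + (\<Sum>x\<leftarrow>xs. tau x * (2 * ?C' x - tau x))"
    by (simp add: sum.distrib sum_g flip: sum_schedule[OF assms(1)])
  finally have "2 * (\<Sum>x\<leftarrow>xs. tau x * (C x - tau x)) \<le> (\<Sum>x\<leftarrow>xs. tau x * (2 * ?C' x - tau x))"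
    by simp
  moreover have "2 * (\<Sum>x\<leftarrow>xs. tau x * (C x - tau x / 2 - ?C' x))
      = 2 * (\<Sum>x\<leftarrow>xs. tau x * (C x - tau x)) - (\<Sum>x\<leftarrow>xs. tau x * (2 * ?C' x - tau x))"
    by (induction xs) (simp_all add: algebra_simps)
  ultimately show ?thesis by linarith
qed

lemma wct_lrf_le:
  assumes "\<And>i. i < n \<Longrightarrow> tau i > 0" and "\<And>i. i < n \<Longrightarrow> w i > 0"
    and "lrf_schedule m n lam tau w S" and "S' \<in> schedules m n"
  shows "wct n lam tau w S \<le> wct n lam tau w S' + (\<Sum>i<n. w i * tau i) / 2"
proof -
  let ?C = "completion_time lam tau S" and ?C' = "completion_time lam tau S'"
  define d where "d x = tau x * (?C x - tau x / 2 - ?C' x)" for x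
  obtain xs E where xs: "lrf_order n tau w xs"
    and run: "lrf_run tau xs (replicate m [], map (\<lambda>j. 2 / lam j) [0..<m]) (S, E)"
    using assms(3) by (auto simp: lrf_schedule_def)
  have dist: "distinct xs" "set xs = {..<n}" and
    sorted: "sorted_wrt (\<lambda>i k. w i / tau i \<ge> w k / tau k) xs"
    using xs by (auto simp: lrf_order_def)
  have prefix: "(\<Sum>x\<leftarrow>ys. d x) \<le> 0" if ys: "xs = ys @ zs" for ys zs
  proof -
    have "load_bound m (\<lambda>j. 2 / lam j) tau ?C []"
      unfolding load_bound_def
    proof (intro allI impI, elim conjE)
      fix L :: "nat \<Rightarrow> real"
      assume "\<forall>j<m. 0 \<le> L j" "(\<Sum>j<m. L j) = (\<Sum>x\<leftarrow>[]. tau x)"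
      then have "\<forall>j\<in>{..<m}. L j = 0"
        by (subst sum_nonneg_eq_0_iff[symmetric]) auto
      then show "(\<Sum>j<m. (2 / lam j)\<^sup>2) + 2 * (\<Sum>x\<leftarrow>[]. tau x * (?C x - tau x))
          \<le> (\<Sum>j<m. (2 / lam j + L j)\<^sup>2)"
        by simp
    qed
    then have "load_bound m (\<lambda>j. 2 / lam j) tau ?C ys"
      using lrf_run_load_bound[OF run, of m n lam "[]" ys zs] lrf_schedule_in_schedules[OF assms(3)]
        assms(1) dist ys by auto
    then show ?thesis
      unfolding d_def using dist ys assms(1)
      by (intro schedule_prefix_bound[OF assms(4)]) auto
  qed
  \<comment> \<open>Abel summation with \<open>c = 0\<close>, below all ratios; the factor
    \<open>tau x\<close> in \<open>d x\<close> turns each ratio back into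
    \<open>w x\<close>.\<close>
  have "(\<Sum>x\<leftarrow>xs. w x / tau x * d x) \<le> 0 * (\<Sum>x\<leftarrow>xs. d x)"
    using sorted prefix dist assms(1,2)
    by (intro sum_list_weighted_le_if_prefix_sums_nonpos) (auto intro: less_imp_le)
  moreover have "(\<Sum>x\<leftarrow>xs. w x / tau x * d x) = (\<Sum>i<n. w i * (?C i - tau i / 2 - ?C' i))"
    unfolding sum_list_distinct_conv_sum_set[OF dist(1)] dist(2)
    using assms(1) by (intro sum.cong) (auto simp: d_def less_imp_neq[symmetric])
  moreover have "\<dots> = wct n lam tau w S - (\<Sum>i<n. w i * tau i) / 2 - wct n lam tau w S'"
    by (simp add: wct_def right_diff_distrib sum_subtractf sum_divide_distrib)
  ultimately show ?thesis by simp
qed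

theorem theorem2:
  fixes m n :: nat and lam tau w :: "nat \<Rightarrow> real" and S :: "nat list list"
  assumes "m \<ge> 1" and "n \<ge> 1"
    and "\<And>j. j < m \<Longrightarrow> lam j > 0"
    and "\<And>i. i < n \<Longrightarrow> tau i > 0"
    and "\<And>i. i < n \<Longrightarrow> w i > 0"
    and "lrf_schedule m n lam tau w S"
  shows "wct n lam tau w S / wct_opt m n lam tau w
    \<le> max (3 / 2)
        ((Max (w ` {..<n}) * Max (lam ` {..<m})) / (Min (w ` {..<n}) * Min (lam ` {..<m})))"
proof -
  obtain S' where S': "S' \<in> schedules m n" and opt: "wct_opt m n lam tau w = wct n lam tau w S'"
    using wct_opt_attained[OF assms(1)] by blast
  \<comment> \<open>No task completes before its own service time has passed, so the additive error
    is at most half the optimum.\<close>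
  have le: "(\<Sum>i<n. w i * tau i) \<le> wct n lam tau w S'"
    unfolding wct_def using assms(3-5) tau_le_completion_time[OF S']
    by (intro sum_mono mult_left_mono) (auto intro: less_imp_le)
  have "0 < (\<Sum>i<n. w i * tau i)"
    using assms(2,4,5) by (intro sum_pos) (auto simp: lessThan_empty_iff)
  then have "wct n lam tau w S / wct_opt m n lam tau w \<le> 3 / 2"
    using wct_lrf_le[OF assms(4-6) S'] le opt by (simp add: divide_le_eq)
  then show ?thesis by (rule max.coboundedI1)
qed

end
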